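(* Let $a\in\mathbb{R}$, let $e\in\mathbb{R}^{p+2}$ be a unit vector, let $\sigma(x)=\langle x,e\rangle$ and $\mathbb{R}^{p+2}_+=\{x\in\mathbb{R}^{p+2}:\sigma(x)>0\}$. An isometric immersion $g$ of a two-dimensional Riemannian manifold $L^2$ into $(\mathbb{R}^{p+2}_+,\langle\cdot,\cdot\rangle)$ is $a$-singular minimal (with density vector $e$) if and only if $g$ is a minimal surface when viewed as an isometric immersion (with respect to the metric it induces on $L^2$) into the Riemannian manifold $(\mathbb{R}^{p+2}_+,\langle\cdot,\cdot\rangle_a)$ endowed with the metric $\langle\cdot,\cdot\rangle_a=\sigma^a\langle\cdot,\cdot\rangle$, where $\langle\cdot,\cdot\rangle$ is the flat Euclidean metric.
   Context: An isometric immersion $g\colon L^2\to\mathbb{R}^{p+2}$ of a two-dimensional Riemannian manifold is an $a$-singular minimal surface with density vector $e$ ($e$ a unit vector, $a\in\mathbb{R}$) if $\phi=\langle g,e\rangle>0$ and its mean curvature vector field $\mathcal{H}_g$ (half the trace of the second fundamental form) satisfies $2\mathcal{H}_g=\frac{a}{\phi}e^\perp$, where $e^\perp$ is the orthogonal projection of $e$ onto the normal bundle of $g$. A surface in a Riemannian manifold is minimal if its mean curvature vector field vanishes. *)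

theory Defs
  imports "HOL-Analysis.Analysis"
begin

subsection \<open>Smooth functions between Euclidean spaces\<close>

text \<open>On an open set, \<open>Ck_on k\<close> is the class of \<open>k\<close> times continuously differentiable functions:
  the directional derivatives in all (equivalently, in all basis) directions are required to
  be of class \<open>k - 1\<close>.\<close>

primrec Ck_on :: "nat \<Rightarrow> 'a set \<Rightarrow> ('a::euclidean_space \<Rightarrow> 'b::real_normed_vector) \<Rightarrow> bool" where
  "Ck_on 0 U f \<longleftrightarrow> continuous_on U f"
| "Ck_on (Suc k) U f \<longleftrightarrow> (\<forall>x\<in>U. f differentiable (at x)) \<and>
     (\<forall>v. Ck_on k U (\<lambda>x. frechet_derivative f (at x) v))"

definition smooth_on :: "'a set \<Rightarrow> ('a::euclidean_space \<Rightarrow> 'b::real_normed_vector) \<Rightarrow> bool" where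
  "smooth_on U f \<longleftrightarrow> (\<forall>k. Ck_on k U f)"


subsection \<open>Riemannian metrics on open subsets of a Euclidean space\<close>

definition inner_product_form :: "('a::real_vector \<Rightarrow> 'a \<Rightarrow> real) \<Rightarrow> bool" where
  "inner_product_form b \<longleftrightarrow>
     bilinear b \<and> (\<forall>u v. b u v = b v u) \<and> (\<forall>u. u \<noteq> 0 \<longrightarrow> b u u > 0)"

type_synonym 'a metric_field = "'a \<Rightarrow> 'a \<Rightarrow> 'a \<Rightarrow> real"

definition riemannian_metric_on :: "'a::euclidean_space set \<Rightarrow> 'a metric_field \<Rightarrow> bool" where
  "riemannian_metric_on U h \<longleftrightarrow> open U \<and> (\<forall>x\<in>U. inner_product_form (h x)) \<and>
     (\<forall>u v. smooth_on U (\<lambda>x. h x u v))"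

text \<open>The Christoffel symbol of the Levi-Civita connection of \<open>h\<close> at \<open>x\<close>, as a vector-valued
  bilinear map, determined by the Koszul formula for constant vector fields \<open>u\<close>, \<open>v\<close>, \<open>w\<close>;
  existence and uniqueness hold since \<open>h x\<close> is an inner product.\<close>

definition christoffel :: "'a::euclidean_space metric_field \<Rightarrow> 'a \<Rightarrow> 'a \<Rightarrow> 'a \<Rightarrow> 'a" where
  "christoffel h x u v = (THE z. \<forall>w. 2 * h x z w =
       frechet_derivative (\<lambda>y. h y v w) (at x) u
     + frechet_derivative (\<lambda>y. h y u w) (at x) v
     - frechet_derivative (\<lambda>y. h y u v) (at x) w)"

definition flat_metric :: "'a::euclidean_space metric_field" where
  "flat_metric x u v = u \<bullet> v"

definition conformal_metric :: "real \<Rightarrow> 'a::euclidean_space \<Rightarrow> 'a metric_field" where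
  "conformal_metric a e x u v = (x \<bullet> e) powr a * flat_metric x u v"

definition upper_half_space :: "'a::euclidean_space \<Rightarrow> 'a set" where
  "upper_half_space e = {x. x \<bullet> e > 0}"


subsection \<open>Two-dimensional Riemannian manifolds\<close>

text \<open>A chart is a pair of its domain and its coordinate map.\<close>

type_synonym 'm chart = "'m set \<times> ('m \<Rightarrow> real^2)"

definition chart_inv :: "'m chart \<Rightarrow> real^2 \<Rightarrow> 'm" where
  "chart_inv ch = inv_into (fst ch) (snd ch)"

definition chart_image :: "'m chart \<Rightarrow> (real^2) set" where
  "chart_image ch = snd ch ` fst ch"

definition smooth_surface :: "'m topology \<Rightarrow> 'm chart set \<Rightarrow> bool" where
  "smooth_surface L A \<longleftrightarrow>
     Hausdorff_space L \<and> second_countable L \<and>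
     (\<Union>ch\<in>A. fst ch) = topspace L \<and>
     (\<forall>ch\<in>A. openin L (fst ch) \<and> open (chart_image ch) \<and>
        homeomorphic_map (subtopology L (fst ch)) (top_of_set (chart_image ch)) (snd ch)) \<and>
     (\<forall>ch\<in>A. \<forall>ch'\<in>A. smooth_on (snd ch ` (fst ch \<inter> fst ch')) (snd ch' \<circ> chart_inv ch))"

text \<open>A tangent vector at \<open>q\<close> is given by its components in a chart around \<open>q\<close>.  The
  differential of \<open>f\<close> at \<open>q\<close> acts on these components as follows.\<close>

definition chart_differential ::
    "('m \<Rightarrow> 'b::real_normed_vector) \<Rightarrow> 'm chart \<Rightarrow> 'm \<Rightarrow> real^2 \<Rightarrow> 'b" where
  "chart_differential f ch q = frechet_derivative (f \<circ> chart_inv ch) (at (snd ch q))"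

text \<open>\<open>\<gamma> ch q u v\<close> is the value of the metric at \<open>q\<close> on the two tangent vectors
  with components \<open>u\<close> and \<open>v\<close> in the chart \<open>ch\<close>; the last clause of \<open>riemannian_surface\<close>
  is the transformation law which makes this a tensor field on the manifold.\<close>

type_synonym 'm surface_metric = "'m chart \<Rightarrow> 'm \<Rightarrow> real^2 \<Rightarrow> real^2 \<Rightarrow> real"

definition riemannian_surface :: "'m topology \<Rightarrow> 'm chart set \<Rightarrow> 'm surface_metric \<Rightarrow> bool" where
  "riemannian_surface L A \<gamma> \<longleftrightarrow>
     smooth_surface L A \<and>
     (\<forall>ch\<in>A. \<forall>q\<in>fst ch. inner_product_form (\<gamma> ch q)) \<and>
     (\<forall>ch\<in>A. \<forall>u v. smooth_on (chart_image ch) (\<lambda>x. \<gamma> ch (chart_inv ch x) u v)) \<and>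
     (\<forall>ch\<in>A. \<forall>ch'\<in>A. \<forall>q \<in> fst ch \<inter> fst ch'. \<forall>u v.
        \<gamma> ch q u v =
        \<gamma> ch' q (chart_differential (snd ch') ch q u) (chart_differential (snd ch') ch q v))"


subsection \<open>Isometric immersions and mean curvature\<close>

definition immersion_into ::
    "'m topology \<Rightarrow> 'm chart set \<Rightarrow> 'a::euclidean_space set \<Rightarrow> ('m \<Rightarrow> 'a) \<Rightarrow> bool" where
  "immersion_into L A U g \<longleftrightarrow> g ` topspace L \<subseteq> U \<and>
     (\<forall>ch\<in>A. smooth_on (chart_image ch) (g \<circ> chart_inv ch)) \<and>
     (\<forall>ch\<in>A. \<forall>q\<in>fst ch. inj (chart_differential g ch q))"

definition induced_metric ::
    "'a::euclidean_space metric_field \<Rightarrow> ('m \<Rightarrow> 'a) \<Rightarrow> 'm surface_metric" where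
  "induced_metric h g ch q u v =
     h (g q) (chart_differential g ch q u) (chart_differential g ch q v)"

definition isometric_immersion ::
    "'m topology \<Rightarrow> 'm chart set \<Rightarrow> 'm surface_metric \<Rightarrow>
     'a::euclidean_space set \<Rightarrow> 'a metric_field \<Rightarrow> ('m \<Rightarrow> 'a) \<Rightarrow> bool" where
  "isometric_immersion L A \<gamma> U h g \<longleftrightarrow>
     riemannian_surface L A \<gamma> \<and> riemannian_metric_on U h \<and> immersion_into L A U g \<and>
     (\<forall>ch\<in>A. \<forall>q\<in>fst ch. \<forall>u v. \<gamma> ch q u v = induced_metric h g ch q u v)"

text \<open>The component of \<open>w\<close> orthogonal, with respect to the inner product \<open>b\<close>, to the
  subspace \<open>T\<close>.\<close>

definition normal_part ::
    "('a \<Rightarrow> 'a \<Rightarrow> real) \<Rightarrow> 'a::euclidean_space set \<Rightarrow> 'a \<Rightarrow> 'a" where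
  "normal_part b T w = (THE n. w - n \<in> T \<and> (\<forall>t\<in>T. b n t = 0))"

definition normal_projection ::
    "'a::euclidean_space metric_field \<Rightarrow> ('m \<Rightarrow> 'a) \<Rightarrow> 'm chart \<Rightarrow> 'm \<Rightarrow> 'a \<Rightarrow> 'a" where
  "normal_projection h g ch q = normal_part (h (g q)) (range (chart_differential g ch q))"

text \<open>The covariant derivative, in the pulled back Levi-Civita connection of \<open>h\<close>, of a
  vector field \<open>\<xi>\<close> along \<open>g\<close> in the direction \<open>u\<close>.\<close>

definition covariant_derivative ::
    "'a::euclidean_space metric_field \<Rightarrow> ('m \<Rightarrow> 'a) \<Rightarrow> 'm chart \<Rightarrow> ('m \<Rightarrow> 'a) \<Rightarrow> 'm \<Rightarrow> real^2 \<Rightarrow> 'a" where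
  "covariant_derivative h g ch \<xi> q u =
     chart_differential \<xi> ch q u
     + christoffel h (g q) (chart_differential g ch q u) (\<xi> q)"

text \<open>The second fundamental form is the normal component of the covariant derivative
  of \<open>g\<^sub>* V\<close> in the direction \<open>u\<close>, where \<open>V\<close> extends \<open>v\<close> to a
  field with constant components in the chart (the value does not depend on the extension).\<close>

definition second_fundamental_form ::
    "'a::euclidean_space metric_field \<Rightarrow> ('m \<Rightarrow> 'a) \<Rightarrow> 'm chart \<Rightarrow> 'm \<Rightarrow> real^2 \<Rightarrow> real^2 \<Rightarrow> 'a" where
  "second_fundamental_form h g ch q u v =
     normal_projection h g ch q
       (covariant_derivative h g ch (\<lambda>r. chart_differential g ch r v) q u)"

definition metric_trace ::
    "(real^2 \<Rightarrow> real^2 \<Rightarrow> real) \<Rightarrow> (real^2 \<Rightarrow> real^2 \<Rightarrow> 'a::real_vector) \<Rightarrow> 'a" where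
  "metric_trace b \<alpha> =
     (\<Sum>i\<in>UNIV. \<Sum>j\<in>UNIV.
        matrix_inv (\<chi> k l. b (axis k 1) (axis l 1)) $ i $ j *\<^sub>R \<alpha> (axis i 1) (axis j 1))"

text \<open>The mean curvature vector at \<open>q\<close>, computed in the chart \<open>ch\<close> around \<open>q\<close>; as a vector
  of the ambient space it does not depend on the chart.\<close>

definition mean_curvature ::
    "'m surface_metric \<Rightarrow> 'a::euclidean_space metric_field \<Rightarrow> ('m \<Rightarrow> 'a) \<Rightarrow> 'm chart \<Rightarrow> 'm \<Rightarrow> 'a" where
  "mean_curvature \<gamma> h g ch q =
     (1/2) *\<^sub>R metric_trace (\<gamma> ch q) (second_fundamental_form h g ch q)"

definition minimal_surface ::
    "'m topology \<Rightarrow> 'm chart set \<Rightarrow> 'm surface_metric \<Rightarrow>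
     'a::euclidean_space set \<Rightarrow> 'a metric_field \<Rightarrow> ('m \<Rightarrow> 'a) \<Rightarrow> bool" where
  "minimal_surface L A \<gamma> U h g \<longleftrightarrow>
     isometric_immersion L A \<gamma> U h g \<and>
     (\<forall>ch\<in>A. \<forall>q\<in>fst ch. mean_curvature \<gamma> h g ch q = 0)"

definition singular_minimal_surface ::
    "real \<Rightarrow> 'a::euclidean_space \<Rightarrow> 'm topology \<Rightarrow> 'm chart set \<Rightarrow> 'm surface_metric \<Rightarrow>
     ('m \<Rightarrow> 'a) \<Rightarrow> bool" where
  "singular_minimal_surface a e L A \<gamma> g \<longleftrightarrow>
     norm e = 1 \<and>
     isometric_immersion L A \<gamma> UNIV flat_metric g \<and>
     (\<forall>q\<in>topspace L. g q \<bullet> e > 0) \<and>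
     (\<forall>ch\<in>A. \<forall>q\<in>fst ch.
        2 *\<^sub>R mean_curvature \<gamma> flat_metric g ch q =
        (a / (g q \<bullet> e)) *\<^sub>R normal_projection flat_metric g ch q e)"

end

theory Submission
  imports Defs
begin

text \<open>For \<open>h = \<sigma>\<^sup>a \<langle>\<cdot>,\<cdot>\<rangle>\<close> the Koszul formula gives the Christoffel map
  \<open>(a / 2\<sigma>) (\<langle>u,e\<rangle> v + \<langle>v,e\<rangle> u - \<langle>u,v\<rangle> e)\<close>.  The metrics have the same normal spaces, and for
  tangent \<open>u\<close>, \<open>v\<close> the first two terms are tangent, so the second fundamental form changes by
  \<open>- (a / 2\<phi>) \<langle>u,v\<rangle> e\<^sup>\<bottom>\<close>, with \<open>e\<^sup>\<bottom>\<close> the normal part of \<open>e\<close>.  The trace of the induced metric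
  with respect to itself is 2, hence the two mean curvature vectors are related by
  \<open>2 \<phi>\<^sup>a H\<^sub>a = 2 H - (a / \<phi>) e\<^sup>\<bottom>\<close>.\<close>

section \<open>Calculus of k times continuously differentiable functions on open sets\<close>

lemma frechet_derivativeI:
  "(f has_derivative f') (at x) \<Longrightarrow> frechet_derivative f (at x) = f'"
  by (rule frechet_derivative_at[symmetric])

text \<open>Near a point of an open set, the values on that set decide differentiability and the
  derivative, so agreement passes from the functions to their derivatives and the induction
  runs.\<close>

lemma Ck_on_cong:
  assumes "open U" "\<And>x. x \<in> U \<Longrightarrow> f x = g x"
  shows "Ck_on k U f \<longleftrightarrow> Ck_on k U g"
  using assms(2)
proof (induction k arbitrary: f g)
  case 0
  then show ?case by (simp cong: continuous_on_cong)
next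
  case (Suc k)
  have *: "(f has_derivative d) (at x) \<longleftrightarrow> (g has_derivative d) (at x)" if "x \<in> U" for d x
    using has_derivative_transform_within_open[OF _ assms(1) that] Suc.prems by metis
  \<comment> \<open>\<open>frechet_derivative\<close> is a choice from the has-derivative predicate.
    Equal predicates give equal choices, even at points where no derivative exists.\<close>
  have "frechet_derivative f (at x) = frechet_derivative g (at x)" if "x \<in> U" for x
    unfolding frechet_derivative_def by (simp add: *[OF that])
  then have "Ck_on k U (\<lambda>x. frechet_derivative f (at x) v) \<longleftrightarrow>
      Ck_on k U (\<lambda>x. frechet_derivative g (at x) v)" for v
    by (intro Suc.IH) simp
  moreover have "f differentiable (at x) \<longleftrightarrow> g differentiable (at x)" if "x \<in> U" for x
    unfolding differentiable_def by (simp add: *[OF that])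
  ultimately show ?case by simp
qed

text \<open>Allows the derivative to be given by an explicit formula valid on \<open>U\<close>: by
  uniqueness it agrees there with \<open>frechet_derivative\<close>, and \<open>Ck_on_cong\<close>
  exchanges the two.\<close>

lemma Ck_on_SucI:
  assumes "open U"
    and "\<And>x. x \<in> U \<Longrightarrow> (f has_derivative f' x) (at x)"
    and "\<And>v. Ck_on k U (\<lambda>x. f' x v)"
  shows "Ck_on (Suc k) U f"
proof -
  have "Ck_on k U (\<lambda>x. frechet_derivative f (at x) v)" for v
    using assms(3)[of v]
    by (subst Ck_on_cong[OF assms(1), where g = "\<lambda>x. f' x v"])
      (auto dest!: assms(2) frechet_derivativeI)
  then show ?thesis using assms(2) by (auto simp: differentiable_def)
qed

lemma Ck_on_SucD: "Ck_on (Suc k) U f \<Longrightarrow> Ck_on k U f"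
proof (induction k arbitrary: f)
  case 0
  then show ?case
    by (auto intro!: continuous_at_imp_continuous_on differentiable_imp_continuous_within)
next
  case (Suc k)
  then show ?case by (metis Ck_on.simps(2))
qed

lemma Ck_on_has_derivative:
  assumes "Ck_on (Suc k) U f" "x \<in> U"
  shows "(f has_derivative frechet_derivative f (at x)) (at x)"
  using assms by (simp add: frechet_derivative_works)

lemma Ck_on_const:
  assumes "open U"
  shows "Ck_on k U (\<lambda>x. c)"
\<comment> \<open>The derivative is the constant 0, so the induction must cover all constants at
  once.\<close>
proof (induction k arbitrary: c)
  case (Suc k)
  show ?case
    by (rule Ck_on_SucI[OF assms has_derivative_const Suc.IH])
qed simp

lemma Ck_on_id:
  assumes "open U"
  shows "Ck_on k U (\<lambda>x. x)"
proof (cases k)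
  case (Suc k')
  show ?thesis
    unfolding Suc by (rule Ck_on_SucI[OF assms has_derivative_ident Ck_on_const[OF assms]])
qed simp

lemma Ck_on_add:
  assumes "open U" "Ck_on k U f" "Ck_on k U g"
  shows "Ck_on k U (\<lambda>x. f x + g x)"
  using assms(2,3)
proof (induction k arbitrary: f g)
  case 0
  then show ?case by (simp add: continuous_on_add)
next
  case (Suc k)
  show ?case
  proof (rule Ck_on_SucI[OF assms(1)])
    show "((\<lambda>x. f x + g x) has_derivative
        (\<lambda>v. frechet_derivative f (at x) v + frechet_derivative g (at x) v)) (at x)"
      if "x \<in> U" for x
      by (rule has_derivative_add Ck_on_has_derivative Suc.prems that)+
    show "Ck_on k U (\<lambda>x. frechet_derivative f (at x) v + frechet_derivative g (at x) v)" for v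
      using Suc.prems by (intro Suc.IH) auto
  qed
qed

lemma Ck_on_mult:
  fixes f g :: "'a::euclidean_space \<Rightarrow> real"
  assumes "open U" "Ck_on k U f" "Ck_on k U g"
  shows "Ck_on k U (\<lambda>x. f x * g x)"
  using assms(2,3)
proof (induction k arbitrary: f g)
  case 0
  then show ?case by (simp add: continuous_on_mult)
next
  case (Suc k)
  show ?case
  proof (rule Ck_on_SucI[OF assms(1)])
    show "((\<lambda>x. f x * g x) has_derivative
        (\<lambda>v. f x * frechet_derivative g (at x) v + frechet_derivative f (at x) v * g x)) (at x)"
      if "x \<in> U" for x
      by (rule has_derivative_mult Ck_on_has_derivative Suc.prems that)+
    show "Ck_on k U
        (\<lambda>x. f x * frechet_derivative g (at x) v + frechet_derivative f (at x) v * g x)" for v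
      \<comment> \<open>Each product pairs a derivative of class \<open>k\<close> with an
        undifferentiated factor of class \<open>Suc k\<close>; the latter is lowered to
        \<open>k\<close> for the induction hypothesis.\<close>
      using Suc.prems Suc.prems[THEN Ck_on_SucD]
      by (intro Ck_on_add[OF assms(1)] Suc.IH) auto
  qed
qed

lemma Ck_on_bounded_linear:
  assumes "open U" "bounded_linear l" "Ck_on k U f"
  shows "Ck_on k U (\<lambda>x. l (f x))"
  using assms(3)
proof (induction k arbitrary: f)
  case 0
  then show ?case using bounded_linear.continuous_on[OF assms(2)] by simp
next
  case (Suc k)
  show ?case
  proof (rule Ck_on_SucI[OF assms(1)])
    show "((\<lambda>x. l (f x)) has_derivative (\<lambda>v. l (frechet_derivative f (at x) v))) (at x)"
      if "x \<in> U" for x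
      by (rule bounded_linear.has_derivative assms(2) Ck_on_has_derivative Suc.prems that)+
    show "Ck_on k U (\<lambda>x. l (frechet_derivative f (at x) v))" for v
      using Suc.prems by (intro Suc.IH) auto
  qed
qed

lemma has_derivative_powr_const:
  fixes f :: "'a::real_normed_vector \<Rightarrow> real"
  assumes "(f has_derivative f') (at x)" "f x > 0"
  shows "((\<lambda>x. f x powr a) has_derivative (\<lambda>v. a * f x powr (a - 1) * f' v)) (at x)"
  using has_derivative_compose[OF assms(1),
      OF has_real_derivative_powr[OF assms(2), of a, unfolded has_field_derivative_def]]
  by (simp add: mult_ac)

lemma Ck_on_powr:
  fixes f :: "'a::euclidean_space \<Rightarrow> real"
  assumes "open U" "Ck_on k U f" "\<And>x. x \<in> U \<Longrightarrow> f x > 0"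
  shows "Ck_on k U (\<lambda>x. f x powr a)"
  using assms(2)
\<comment> \<open>Differentiation lowers the exponent to \<open>a - 1\<close>, hence the
  generalization over \<open>a\<close>.\<close>
proof (induction k arbitrary: a)
  case 0
  then show ?case using assms(3) by (fastforce intro: continuous_on_powr)
next
  case (Suc k)
  show ?case
  proof (rule Ck_on_SucI[OF assms(1)])
    show "((\<lambda>x. f x powr a) has_derivative
        (\<lambda>v. a * f x powr (a - 1) * frechet_derivative f (at x) v)) (at x)"
      if "x \<in> U" for x
      by (rule has_derivative_powr_const Ck_on_has_derivative Suc.prems assms(3) that)+
    have "Ck_on k U (\<lambda>x. frechet_derivative f (at x) v)" for v
      using Suc.prems by simp
    then show "Ck_on k U (\<lambda>x. a * f x powr (a - 1) * frechet_derivative f (at x) v)" for v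
      by (intro Ck_on_mult[OF assms(1)] Ck_on_const[OF assms(1)] Suc.IH Ck_on_SucD[OF Suc.prems])
  qed
qed

section \<open>The flat and conformal metrics and their Levi-Civita connections\<close>

lemma open_upper_half_space: "open (upper_half_space e)"
  unfolding upper_half_space_def by (simp add: open_halfspace_gt inner_commute[of _ e])

lemma inner_product_form_inner:
  "inner_product_form ((\<bullet>) :: 'a::euclidean_space \<Rightarrow> 'a \<Rightarrow> real)"
  unfolding inner_product_form_def
  by (auto simp: bilinear_def linear_iff inner_add inner_commute)

lemma inner_product_form_scale:
  assumes "inner_product_form b" "c > 0"
  shows "inner_product_form (\<lambda>u v. c * b u v)"
  using assms unfolding inner_product_form_def bilinear_def linear_iff
  by (auto simp: algebra_simps)

lemma riemannian_metric_on_flat: "open U \<Longrightarrow> riemannian_metric_on U flat_metric"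
  unfolding riemannian_metric_on_def flat_metric_def smooth_on_def
  by (auto intro: Ck_on_const inner_product_form_inner)

lemma riemannian_metric_on_conformal:
  "riemannian_metric_on (upper_half_space e) (conformal_metric a e)"
  unfolding riemannian_metric_on_def
proof (intro conjI ballI allI open_upper_half_space)
  fix x assume "x \<in> upper_half_space e"
  then show "inner_product_form (conformal_metric a e x)"
    unfolding conformal_metric_def flat_metric_def upper_half_space_def
    by (intro inner_product_form_scale inner_product_form_inner) auto
next
  fix u v :: 'a
  show "smooth_on (upper_half_space e) (\<lambda>x. conformal_metric a e x u v)"
    unfolding smooth_on_def conformal_metric_def flat_metric_def
  proof
    fix k
    let ?U = "upper_half_space e"
    have "Ck_on k ?U (\<lambda>x. x \<bullet> e)"
      by (rule Ck_on_bounded_linear[OF open_upper_half_space bounded_linear_inner_left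
            Ck_on_id[OF open_upper_half_space]])
    then have "Ck_on k ?U (\<lambda>x. (x \<bullet> e) powr a)"
      by (rule Ck_on_powr[OF open_upper_half_space]) (simp add: upper_half_space_def)
    then show "Ck_on k ?U (\<lambda>x. (x \<bullet> e) powr a * (u \<bullet> v))"
      by (rule Ck_on_mult[OF open_upper_half_space _ Ck_on_const[OF open_upper_half_space]])
  qed
qed

lemma christoffel_flat: "christoffel flat_metric x u v = 0"
proof -
  \<comment> \<open>Constant coefficients make the right side of the Koszul formula vanish;
    nondegeneracy then singles out \<open>z = 0\<close>.\<close>
  have "(\<forall>w. z \<bullet> w = 0) \<longleftrightarrow> z = 0" for z :: 'a
    by (metis inner_eq_zero_iff inner_zero_left)
  then show ?thesis
    unfolding christoffel_def flat_metric_def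
    by (simp add: frechet_derivativeI[OF has_derivative_const])
qed

lemma christoffel_conformal:
  assumes "x \<bullet> e > 0"
  shows "christoffel (conformal_metric a e) x u v =
    (a / (2 * (x \<bullet> e))) *\<^sub>R ((u \<bullet> e) *\<^sub>R v + (v \<bullet> e) *\<^sub>R u - (u \<bullet> v) *\<^sub>R e)" (is "_ = ?z")
proof -
  have "((\<lambda>y. (y \<bullet> e) powr a * (s \<bullet> t)) has_derivative
      (\<lambda>w. a * (x \<bullet> e) powr (a - 1) * (w \<bullet> e) * (s \<bullet> t))) (at x)" for s t :: 'a
    by (rule has_derivative_mult_left has_derivative_powr_const
        bounded_linear.has_derivative[OF bounded_linear_inner_left has_derivative_ident] assms)+
  note D = this[THEN frechet_derivativeI]
  \<comment> \<open>Exposes the common factor \<open>(x \<bullet> e) powr a\<close> of both sides of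
    the Koszul formula; its positivity allows cancelling it in the uniqueness argument.\<close>
  have P: "(x \<bullet> e) powr (a - 1) = (x \<bullet> e) powr a / (x \<bullet> e)" "(x \<bullet> e) powr a > 0"
    using assms by (auto simp: powr_diff)
  have z: "2 * ((x \<bullet> e) powr a * (?z \<bullet> w)) =
      a * (x \<bullet> e) powr (a - 1) * (u \<bullet> e) * (v \<bullet> w)
      + a * (x \<bullet> e) powr (a - 1) * (v \<bullet> e) * (u \<bullet> w)
      - a * (x \<bullet> e) powr (a - 1) * (w \<bullet> e) * (u \<bullet> v)" for w
    using assms unfolding P(1)
    by (simp add: inner_add_left inner_diff_left inner_commute[of e w] field_simps)
  show ?thesis
    unfolding christoffel_def conformal_metric_def flat_metric_def D
  proof (rule the_equality)
    fix z assume "\<forall>w. 2 * ((x \<bullet> e) powr a * (z \<bullet> w)) =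
      a * (x \<bullet> e) powr (a - 1) * (u \<bullet> e) * (v \<bullet> w)
      + a * (x \<bullet> e) powr (a - 1) * (v \<bullet> e) * (u \<bullet> w)
      - a * (x \<bullet> e) powr (a - 1) * (w \<bullet> e) * (u \<bullet> v)"
    then have "2 * ((x \<bullet> e) powr a * (z \<bullet> w)) = 2 * ((x \<bullet> e) powr a * (?z \<bullet> w))" for w
      using z by metis
    then have "z \<bullet> w = ?z \<bullet> w" for w
      using P(2) by (metis less_irrefl mult_left_cancel zero_neq_numeral)
    then show "z = ?z" by (metis vector_eq_rdot)
  qed (use z in blast)
qed

section \<open>Normal parts and the second fundamental form\<close>

lemma normal_part_inner_eqI:
  assumes "subspace T" "w - n \<in> T" "\<And>t. t \<in> T \<Longrightarrow> n \<bullet> t = 0"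
  shows "normal_part (\<bullet>) T w = n"
  unfolding normal_part_def
proof (rule the_equality)
  fix m assume m: "w - m \<in> T \<and> (\<forall>t\<in>T. m \<bullet> t = 0)"
  \<comment> \<open>The difference of two candidates lies in \<open>T\<close> and is orthogonal to
    \<open>T\<close>, hence to itself.\<close>
  have "m - n \<in> T"
    using subspace_diff[OF assms(1,2), of "w - m"] m by simp
  then have "(m - n) \<bullet> (m - n) = 0"
    using m assms(3) by (simp add: inner_diff_left)
  then show "m = n" by simp
qed (use assms in auto)

text \<open>Existence comes from the orthogonal decomposition along \<open>T\<close>, so the
  definite description in \<open>normal_part\<close> denotes what is intended.\<close>

lemma normal_part_inner_props:
  assumes "subspace T"
  shows "w - normal_part (\<bullet>) T w \<in> T" "t \<in> T \<Longrightarrow> normal_part (\<bullet>) T w \<bullet> t = 0"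
proof -
  obtain y z where "y \<in> span T" "\<And>t. t \<in> span T \<Longrightarrow> orthogonal z t" "w = y + z"
    using orthogonal_subspace_decomp_exists[of T w] by metis
  then have "y \<in> T" "\<And>t. t \<in> T \<Longrightarrow> z \<bullet> t = 0" "w - z = y"
    using assms by (auto simp: span_eq_iff[THEN iffD2] orthogonal_def)
  moreover from this have "normal_part (\<bullet>) T w = z"
    using assms by (intro normal_part_inner_eqI) auto
  ultimately show "w - normal_part (\<bullet>) T w \<in> T" "t \<in> T \<Longrightarrow> normal_part (\<bullet>) T w \<bullet> t = 0"
    by auto
qed

text \<open>Linearity of the projection, shaped for the conformal covariant derivative:
  \<open>w\<close> is the flat derivative, \<open>s\<close> collects the tangent Christoffel terms,
  and \<open>x\<close> is the density vector.\<close>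

lemma normal_part_inner_add_scale:
  assumes "subspace T" "s \<in> T"
  shows "normal_part (\<bullet>) T (w + s + c *\<^sub>R x) = normal_part (\<bullet>) T w + c *\<^sub>R normal_part (\<bullet>) T x"
proof (rule normal_part_inner_eqI[OF assms(1)])
  note N = normal_part_inner_props[OF assms(1)]
  have "(w - normal_part (\<bullet>) T w) + s + c *\<^sub>R (x - normal_part (\<bullet>) T x) \<in> T"
    using assms N(1) by (intro subspace_add subspace_scale)
  then show "w + s + c *\<^sub>R x - (normal_part (\<bullet>) T w + c *\<^sub>R normal_part (\<bullet>) T x) \<in> T"
    by (simp add: algebra_simps)
  show "(normal_part (\<bullet>) T w + c *\<^sub>R normal_part (\<bullet>) T x) \<bullet> t = 0" if "t \<in> T" for t
    using N(2)[OF that] by (simp add: inner_add_left)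
qed

text \<open>A nonzero factor does not affect orthogonality, so both descriptions have the same
  defining predicate.\<close>

lemma normal_part_scale:
  fixes c :: real
  assumes "c \<noteq> 0"
  shows "normal_part (\<lambda>u v. c * b u v) T w = normal_part b T w"
  using assms unfolding normal_part_def by simp

lemma normal_projection_flat:
  "normal_projection flat_metric g ch q = normal_part (\<bullet>) (range (chart_differential g ch q))"
  unfolding normal_projection_def flat_metric_def by simp

lemma normal_projection_conformal:
  assumes "g q \<bullet> e > 0"
  shows "normal_projection (conformal_metric a e) g ch q = normal_projection flat_metric g ch q"
  using assms unfolding normal_projection_def conformal_metric_def
  by (intro ext) (simp add: normal_part_scale)

lemma second_fundamental_form_conformal:
  assumes "g q \<bullet> e > 0" and lin: "linear (chart_differential g ch q)"
  shows "second_fundamental_form (conformal_metric a e) g ch q u v =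
    second_fundamental_form flat_metric g ch q u v
    - (a / (2 * (g q \<bullet> e)) * induced_metric flat_metric g ch q u v) *\<^sub>R
      normal_projection flat_metric g ch q e"
proof -
  let ?D = "chart_differential g ch q"
  let ?k = "a / (2 * (g q \<bullet> e))"
  have T: "subspace (range ?D)"
    using lin by (simp add: linear_subspace_image)
  \<comment> \<open>These Christoffel terms are tangent and drop out of the normal part; the
    remaining one, along \<open>e\<close>, supplies the scalar inserted in \<open>N\<close>.\<close>
  have "?k *\<^sub>R ((?D u \<bullet> e) *\<^sub>R ?D v + (?D v \<bullet> e) *\<^sub>R ?D u) \<in> range ?D"
    by (intro subspace_scale subspace_add T) auto
  note N = normal_part_inner_add_scale[OF T this, of _ "- (?k * (?D u \<bullet> ?D v))" e]
  show ?thesis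
    unfolding second_fundamental_form_def normal_projection_conformal[of g q e, OF assms(1)]
      covariant_derivative_def christoffel_conformal[OF assms(1)] christoffel_flat
      normal_projection_flat induced_metric_def flat_metric_def
    using N[of "chart_differential (\<lambda>r. chart_differential g ch r v) ch q u"]
    by (simp add: algebra_simps)
qed

section \<open>Inverse Gram matrices and metric traces\<close>

lemma
  fixes A :: "'a::semiring_1^'n^'m"
  assumes "invertible A"
  shows matrix_inv_right: "A ** matrix_inv A = mat 1"
    and matrix_inv_left: "matrix_inv A ** A = mat 1"
  using someI_ex[OF assms[unfolded invertible_def]] unfolding matrix_inv_def by auto

lemma matrix_inv_scale:
  fixes A :: "real^'n^'n"
  assumes "invertible A" "c \<noteq> 0"
  shows "matrix_inv (c *\<^sub>R A) = (1 / c) *\<^sub>R matrix_inv A"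
proof -
  have inv: "invertible (c *\<^sub>R A)"
    using assms by (metis scalar_invertible)
  have "((1 / c) *\<^sub>R matrix_inv A) ** (c *\<^sub>R A) = mat 1"
    using assms by (simp add: matrix_inv_left matrix_scalar_ac flip: scalar_matrix_assoc)
  \<comment> \<open>Comparing a left inverse with the right inverse
    \<open>matrix_inv (c *\<^sub>R A)\<close> by reassociating the triple product.\<close>
  then have "matrix_inv (c *\<^sub>R A) =
      ((1 / c) *\<^sub>R matrix_inv A) ** (c *\<^sub>R A) ** matrix_inv (c *\<^sub>R A)"
    by simp
  also have "\<dots> = (1 / c) *\<^sub>R matrix_inv A"
    unfolding matrix_mul_assoc[symmetric] matrix_inv_right[OF inv] by simp
  finally show ?thesis .
qed

text \<open>A kernel vector pairs to zero with every axis vector, hence with itself, and vanishes by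
  positive definiteness.\<close>

lemma invertible_gram_matrix:
  fixes b :: "real^'n \<Rightarrow> real^'n \<Rightarrow> real"
  assumes "inner_product_form b"
  shows "invertible (\<chi> k l. b (axis k 1) (axis l 1))" (is "invertible ?G")
proof -
  have bil: "bilinear b" and sym: "b u v = b v u"
    and pos: "u \<noteq> 0 \<Longrightarrow> b u u > 0" for u v
    using assms unfolding inner_product_form_def by auto
  have "x = 0" if "?G *v x = 0" for x
  proof -
    have "(\<Sum>l\<in>UNIV. b (axis k 1) (axis l 1) * x $ l) = 0" for k
      using that by (simp add: vec_eq_iff matrix_vector_mult_def)
    moreover have "b (axis k 1) x = (\<Sum>l\<in>UNIV. b (axis k 1) (axis l 1) * x $ l)" for k
    proof -
      have "b (axis k 1) x = b (axis k 1) (\<Sum>l\<in>UNIV. x $ l *\<^sub>R axis l 1)"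
        using basis_expansion[of x] by (simp add: scalar_mult_eq_scaleR)
      also have "\<dots> = (\<Sum>l\<in>UNIV. b (axis k 1) (axis l 1) * x $ l)"
        using bil by (simp add: bilinear_def linear_sum linear_cmul mult.commute)
      finally show ?thesis .
    qed
    ultimately have 0: "b (axis k 1) x = 0" for k by simp
    have "b x x = b (\<Sum>k\<in>UNIV. x $ k *\<^sub>R axis k 1) x"
      using basis_expansion[of x] by (simp add: scalar_mult_eq_scaleR)
    also have "\<dots> = (\<Sum>k\<in>UNIV. x $ k * b (axis k 1) x)"
    proof -
      have "linear (\<lambda>y. b y x)" using bil by (simp add: bilinear_def)
      then show ?thesis by (simp add: linear_sum[of "\<lambda>y. b y x"] linear_cmul[of "\<lambda>y. b y x"])
    qed
    finally show ?thesis using 0 pos[of x] by fastforce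
  qed
  then show ?thesis
    by (simp add: invertible_left_inverse matrix_left_invertible_ker)
qed

text \<open>The sum is the trace of the inverse Gram matrix times the Gram matrix, that is, of the
  identity in dimension two.\<close>

lemma metric_trace_self:
  assumes "inner_product_form b"
  shows "metric_trace b b = 2"
proof -
  let ?G = "\<chi> k l. b (axis k 1) (axis l 1)"
  have "matrix_inv ?G ** ?G = mat 1"
    by (rule matrix_inv_left[OF invertible_gram_matrix[OF assms]])
  then have "(\<Sum>j\<in>UNIV. matrix_inv ?G $ i $ j * b (axis j 1) (axis i 1)) = 1" for i
    by (simp add: vec_eq_iff matrix_matrix_mult_def mat_def)
  \<comment> \<open>Symmetry reconciles the index order of \<open>metric_trace\<close> with that of
    the matrix product.\<close>
  moreover have "b u v = b v u" for u v
    using assms by (simp add: inner_product_form_def)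
  ultimately show ?thesis
    unfolding metric_trace_def by simp
qed

text \<open>The Gram matrix scales by \<open>c\<close>, so its inverse scales by
  \<open>1 / c\<close>, while \<open>\<alpha>\<close> stays fixed.\<close>

lemma metric_trace_scale_metric:
  assumes "inner_product_form b" "c \<noteq> 0"
  shows "metric_trace (\<lambda>u v. c * b u v) \<alpha> = (1 / c) *\<^sub>R metric_trace b \<alpha>"
proof -
  have "(\<chi> k l. c * b (axis k 1) (axis l 1)) = c *\<^sub>R (\<chi> k l. b (axis k 1) (axis l 1))"
    by (simp add: vec_eq_iff)
  then show ?thesis
    using matrix_inv_scale[OF invertible_gram_matrix[OF assms(1)] assms(2)]
    unfolding metric_trace_def by (simp add: scaleR_sum_right)
qed

lemma metric_trace_diff:
  "metric_trace b (\<lambda>u v. \<alpha> u v - \<beta> u v) = metric_trace b \<alpha> - metric_trace b \<beta>"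
  unfolding metric_trace_def by (simp add: scaleR_diff_right sum_subtractf)

lemma metric_trace_scaleR_const:
  "metric_trace b (\<lambda>u v. (k * \<beta> u v) *\<^sub>R w) = (k * metric_trace b \<beta>) *\<^sub>R w"
  unfolding metric_trace_def
  by (simp add: scaleR_sum_left sum_distrib_left mult_ac)

section \<open>Mean curvature under the conformal change\<close>

lemma induced_metric_conformal:
  "induced_metric (conformal_metric a e) g ch q u v =
    (g q \<bullet> e) powr a * induced_metric flat_metric g ch q u v"
  unfolding induced_metric_def conformal_metric_def ..

text \<open>The self-trace 2 cancels the 2 in the coefficient
  \<open>a / (2 * (g q \<bullet> e))\<close>. The resulting bracket is the defect in the singular
  minimal equation, and its prefactor never vanishes.\<close>

lemma mean_curvature_conformal:
  assumes pos: "g q \<bullet> e > 0" and lin: "linear (chart_differential g ch q)"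
    and ipf: "inner_product_form (induced_metric flat_metric g ch q)"
  shows "mean_curvature (induced_metric (conformal_metric a e) g) (conformal_metric a e) g ch q =
    (1 / (2 * (g q \<bullet> e) powr a)) *\<^sub>R
      (2 *\<^sub>R mean_curvature (induced_metric flat_metric g) flat_metric g ch q
       - (a / (g q \<bullet> e)) *\<^sub>R normal_projection flat_metric g ch q e)"
proof -
  let ?b = "induced_metric flat_metric g ch q"
  let ?\<alpha> = "second_fundamental_form flat_metric g ch q"
  let ?N = "normal_projection flat_metric g ch q e"
  have P: "(g q \<bullet> e) powr a \<noteq> 0" using pos by simp
  have "induced_metric (conformal_metric a e) g ch q = (\<lambda>u v. (g q \<bullet> e) powr a * ?b u v)"
    by (intro ext) (rule induced_metric_conformal)
  moreover have "second_fundamental_form (conformal_metric a e) g ch q =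
      (\<lambda>u v. ?\<alpha> u v - (a / (2 * (g q \<bullet> e)) * ?b u v) *\<^sub>R ?N)"
    by (intro ext second_fundamental_form_conformal pos lin)
  ultimately have "metric_trace (induced_metric (conformal_metric a e) g ch q)
        (second_fundamental_form (conformal_metric a e) g ch q) =
      (1 / (g q \<bullet> e) powr a) *\<^sub>R (metric_trace ?b ?\<alpha> - (a / (g q \<bullet> e)) *\<^sub>R ?N)"
    by (simp only: metric_trace_scale_metric[OF ipf P] metric_trace_diff
        metric_trace_scaleR_const metric_trace_self[OF ipf]) simp
  then show ?thesis
    unfolding mean_curvature_def by simp
qed

section \<open>Isometric immersions for the two metrics, and the equivalence\<close>

lemma immersion_into_linear_differential:
  assumes "immersion_into L A U g" "ch \<in> A" "q \<in> fst ch"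
  shows "linear (chart_differential g ch q)"
proof -
  have "Ck_on (Suc 0) (chart_image ch) (g \<circ> chart_inv ch)" "snd ch q \<in> chart_image ch"
    using assms unfolding immersion_into_def smooth_on_def chart_image_def by blast+
  then show ?thesis
    unfolding chart_differential_def by (intro linear_frechet_derivative) simp
qed

text \<open>Bridges the targets: singular minimality is stated with the whole space as ambient
  manifold, while the given immersion lands in the half-space.\<close>

lemma isometric_immersion_flat_UNIV:
  assumes "isometric_immersion L A \<gamma> U flat_metric g"
  shows "isometric_immersion L A \<gamma> UNIV flat_metric g"
  using assms riemannian_metric_on_flat[of UNIV]
  unfolding isometric_immersion_def immersion_into_def by auto

text \<open>At chart points the new induced metric is \<open>\<gamma>\<close> times the positive
  smooth function \<open>(g q \<bullet> e) powr a\<close>, so the Riemannian surface axioms carry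
  over.\<close>

lemma isometric_immersion_conformal:
  assumes "isometric_immersion L A \<gamma> (upper_half_space e) flat_metric g"
  shows "isometric_immersion L A (induced_metric (conformal_metric a e) g)
    (upper_half_space e) (conformal_metric a e) g"
proof -
  from assms have rs: "riemannian_surface L A \<gamma>" and im: "immersion_into L A (upper_half_space e) g"
    and iso: "\<And>ch q u v. ch \<in> A \<Longrightarrow> q \<in> fst ch \<Longrightarrow> induced_metric flat_metric g ch q u v = \<gamma> ch q u v"
    unfolding isometric_immersion_def by auto
  from rs have ss: "smooth_surface L A" unfolding riemannian_surface_def by blast
  have pos: "g q \<bullet> e > 0" if "ch \<in> A" "q \<in> fst ch" for ch q
    using ss im that unfolding smooth_surface_def immersion_into_def upper_half_space_def by blast
  have eq: "induced_metric (conformal_metric a e) g ch q u v = (g q \<bullet> e) powr a * \<gamma> ch q u v"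
    if "ch \<in> A" "q \<in> fst ch" for ch q u v
    by (simp add: induced_metric_conformal iso[OF that])
  have "inner_product_form (induced_metric (conformal_metric a e) g ch q)"
    if "ch \<in> A" "q \<in> fst ch" for ch q
  proof -
    have "inner_product_form (\<gamma> ch q)"
      using rs that unfolding riemannian_surface_def by blast
    moreover have "(g q \<bullet> e) powr a > 0"
      using pos[OF that] by simp
    ultimately show ?thesis
      unfolding eq[OF that, abs_def] by (rule inner_product_form_scale)
  qed
  moreover have "smooth_on (chart_image ch)
      (\<lambda>x. induced_metric (conformal_metric a e) g ch (chart_inv ch x) u v)"
    if ch: "ch \<in> A" for ch u v
  proof -
    have op: "open (chart_image ch)"
      using ss ch unfolding smooth_surface_def by blast
    have inv: "chart_inv ch x \<in> fst ch" if "x \<in> chart_image ch" for x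
      using that unfolding chart_inv_def chart_image_def by (rule inv_into_into)
    have g: "Ck_on k (chart_image ch) (\<lambda>x. g (chart_inv ch x))" for k
      using im ch unfolding immersion_into_def smooth_on_def by (simp add: o_def)
    have \<gamma>: "Ck_on k (chart_image ch) (\<lambda>x. \<gamma> ch (chart_inv ch x) u v)" for k
      using rs ch unfolding riemannian_surface_def smooth_on_def by blast
    have "Ck_on k (chart_image ch)
        (\<lambda>x. (g (chart_inv ch x) \<bullet> e) powr a * \<gamma> ch (chart_inv ch x) u v)" for k
      by (rule Ck_on_mult[OF op Ck_on_powr[OF op
              Ck_on_bounded_linear[OF op bounded_linear_inner_left g] pos[OF ch inv]] \<gamma>])
    then show ?thesis
      unfolding smooth_on_def
      \<comment> \<open>The product formula holds only over the chart image, so it is substituted by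
        congruence on that open set.\<close>
      by (subst Ck_on_cong[OF op eq[OF ch inv]]) auto
  qed
  moreover have "induced_metric (conformal_metric a e) g ch q u v =
      induced_metric (conformal_metric a e) g ch' q
        (chart_differential (snd ch') ch q u) (chart_differential (snd ch') ch q v)"
    if "ch \<in> A" "ch' \<in> A" "q \<in> fst ch \<inter> fst ch'" for ch ch' q u v
  proof -
    have "\<gamma> ch q u v =
        \<gamma> ch' q (chart_differential (snd ch') ch q u) (chart_differential (snd ch') ch q v)"
      using rs that unfolding riemannian_surface_def by blast
    \<comment> \<open>The conformal factor depends on the point \<open>q\<close> and not on the
      chart, so it multiplies both sides of the transformation law of \<open>\<gamma>\<close>
      equally.\<close>
    with that show ?thesis by (simp add: eq)
  qed
  ultimately have "riemannian_surface L A (induced_metric (conformal_metric a e) g)"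
    unfolding riemannian_surface_def using ss by blast
  then show ?thesis
    unfolding isometric_immersion_def using riemannian_metric_on_conformal im by blast
qed

theorem theorem2:
  fixes a :: real and p :: nat and e :: "real^'n"
    and L :: "'m topology" and A :: "'m chart set" and \<gamma> :: "'m surface_metric"
    and g :: "'m \<Rightarrow> real^'n"
  assumes "CARD('n) = p + 2"
    and "norm e = 1"
    and "isometric_immersion L A \<gamma> (upper_half_space e) flat_metric g"
  shows "singular_minimal_surface a e L A \<gamma> g \<longleftrightarrow>
    minimal_surface L A (induced_metric (conformal_metric a e) g)
      (upper_half_space e) (conformal_metric a e) g"
proof -
  from assms(3) have rs: "riemannian_surface L A \<gamma>" and im: "immersion_into L A (upper_half_space e) g"
    and iso: "\<And>ch q u v. ch \<in> A \<Longrightarrow> q \<in> fst ch \<Longrightarrow> \<gamma> ch q u v = induced_metric flat_metric g ch q u v"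
    unfolding isometric_immersion_def by auto
  have pos: "\<forall>q\<in>topspace L. g q \<bullet> e > 0"
    using im unfolding immersion_into_def upper_half_space_def by blast
  \<comment> \<open>The two curvature equations are equivalent point by point; the other conjuncts
    on both sides follow from the assumptions.\<close>
  have "mean_curvature (induced_metric (conformal_metric a e) g) (conformal_metric a e) g ch q = 0
      \<longleftrightarrow> 2 *\<^sub>R mean_curvature \<gamma> flat_metric g ch q =
        (a / (g q \<bullet> e)) *\<^sub>R normal_projection flat_metric g ch q e"
    if ch: "ch \<in> A" "q \<in> fst ch" for ch q
  proof -
    have q: "g q \<bullet> e > 0"
      using rs pos ch unfolding riemannian_surface_def smooth_surface_def by blast
    have \<gamma>: "\<gamma> ch q = induced_metric flat_metric g ch q"
      using iso[OF ch] by blast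
    moreover have "inner_product_form (\<gamma> ch q)"
      using rs ch unfolding riemannian_surface_def by blast
    ultimately have "inner_product_form (induced_metric flat_metric g ch q)"
      by simp
    note mean_curvature_conformal[OF q immersion_into_linear_differential[OF im ch] this, of a]
    \<comment> \<open>\<open>mean_curvature\<close> reads the surface metric only at
      \<open>ch\<close> and \<open>q\<close>, so the agreement of \<open>\<gamma>\<close> with the
      induced metric there suffices.\<close>
    moreover have "mean_curvature \<gamma> flat_metric g ch q =
        mean_curvature (induced_metric flat_metric g) flat_metric g ch q"
      by (simp add: mean_curvature_def \<gamma>)
    ultimately show ?thesis using q by simp
  qed
  then show ?thesis
    unfolding singular_minimal_surface_def minimal_surface_def
    using assms(2) pos isometric_immersion_flat_UNIV[OF assms(3)]
      isometric_immersion_conformal[OF assms(3)] by auto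
qed

end
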